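(* Let $n>1$ be an integer with $\gcd(n,6)=1$. Then the following three congruences hold: $$\sum_{\substack{r=1\\ \gcd(r,n)=1}}^{\lfloor n/3\rfloor}\frac{1}{n-3r}\equiv\frac12\, q_n(3)-\frac14\, n\,q_n(3)^2\pmod{n^2},$$ $$\sum_{\substack{r=1\\ \gcd(r,n)=1}}^{\lfloor n/4\rfloor}\frac{1}{n-4r}\equiv\frac34\, q_n(2)-\frac38\, n\,q_n(2)^2\pmod{n^2},$$ and $$\sum_{\substack{r=1\\ \gcd(r,n)=1}}^{\lfloor n/6\rfloor}\frac{1}{n-6r}\equiv\frac13\, q_n(2)+\frac14\, q_n(3)-n\left(\frac16\, q_n(2)^2+\frac18\, q_n(3)^2\right)\pmod{n^2}.$$
   Context: For a positive integer $n$ and an integer $a$ with $\gcd(a,n)=1$, the Fermat quotient is $q_n(a)=\dfrac{a^{\phi(n)}-1}{n}$ (an integer), where $\phi$ is Euler's totient function. Congruences between rational numbers whose denominators are coprime to the modulus are understood in the usual sense: $x\equiv y\pmod m$ means that the numerator of $x-y$ in lowest terms is divisible by $m$ (equivalently, $1/b$ is read as the inverse of $b$ modulo $m$). Empty sums are $0$. *)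

theory Defs
  imports Complex_Main "HOL-Number_Theory.Number_Theory"
begin

text \<open>The rational values below are integers whenever \<open>n > 0\<close> and \<open>coprime a (int n)\<close>,
  see \<open>fermat_quotient_in_Ints\<close>.\<close>

definition fermat_quotient :: "nat \<Rightarrow> int \<Rightarrow> rat" where
  "fermat_quotient n a = (of_int a ^ totient n - 1) / of_nat n"

lemma fermat_quotient_in_Ints:
  assumes "n > 0" "coprime a (int n)"
  shows "fermat_quotient n a \<in> \<int>"
proof -
  have "[a ^ totient n = 1] (mod int n)"
  proof (cases "n = 1")
    case False
    then have "residues (int n)"
      using assms(1) by (simp add: residues_def)
    from residues.euler_theorem [OF this assms(2)] show ?thesis by simp
  qed simp
  then have "int n dvd a ^ totient n - 1"
    by (simp add: cong_iff_dvd_diff)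
  then obtain k where "a ^ totient n - 1 = int n * k" ..
  then have "of_int a ^ totient n - 1 = (of_nat n * of_int k :: rat)"
    by (metis of_int_1 of_int_diff of_int_mult of_int_of_nat_eq of_int_power)
  then have "fermat_quotient n a = of_int k"
    using assms(1) by (simp add: fermat_quotient_def)
  then show ?thesis by simp
qed

text \<open>\<^const>\<open>quotient_of\<close> yields the numerator and denominator in lowest terms, with positive
  denominator, so the condition also forces the denominator of \<open>x - y\<close> to be coprime to \<open>m\<close>.\<close>

definition rat_cong :: "rat \<Rightarrow> rat \<Rightarrow> int \<Rightarrow> bool"  (\<open>(1[_ = _] '(rmod _'))\<close>) where
  "[x = y] (rmod m) \<longleftrightarrow> m dvd fst (quotient_of (x - y))"

end

theory Submission
  imports Defs
begin

text \<open>Substituting \<open>s = n - m r\<close> turns the sum into a sum \<open>T\<^sub>1(m, m - 1)\<close> of \<open>1/s\<close> over the units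
  \<open>s < n\<close> lying in one residue class modulo \<open>m\<close>. Division by \<open>m\<close> modulo \<open>n\<close> permutes the units,
  \<open>s\<close> going to \<open>(s + k\<^sub>s n) / m\<close> with \<open>0 \<le> k\<^sub>s < m\<close>; multiplying over all units gives
  \<open>m\<^bsup>\<phi>(n)\<^esup> = \<Prod> (1 + n k\<^sub>s / s)\<close>. Expanding to second order yields
  \<open>\<Sum> k\<^sub>s / s \<equiv> q - n q\<^sup>2 / 2 + (n / 2) \<Sum> k\<^sub>s\<^sup>2 / s\<^sup>2\<close> modulo \<open>n\<^sup>2\<close> for \<open>q = q\<^sub>n(m)\<close>, which is a linear
  relation between the class sums of \<open>1/s\<close> and of \<open>1/s\<^sup>2\<close>. The reflection \<open>s \<mapsto> n - s\<close>, the
  vanishing of the full sums, and the decomposition of the classes modulo 2 and 3 into classes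
  modulo 4 and 6 give enough further linear relations to solve for \<open>T\<^sub>1(m, m - 1)\<close>.\<close>

section \<open>Rationals with denominator coprime to \<open>n\<close>\<close>

locale coprime_six =
  fixes n :: nat
  assumes n_gt_1: "n > 1" and coprime_6: "coprime n 6"
begin

abbreviation N :: rat where "N \<equiv> of_nat n"

text \<open>The localization of the integers at the denominators prime to \<open>n\<close>.
  Fractions may be unreduced, so closure under sums and products involves no cancellation.\<close>

definition R :: "rat set" where
  "R = {of_int a / of_int b | a b. b \<noteq> 0 \<and> coprime b (int n)}"

text \<open>Congruence modulo the ideal \<open>N ^ k * R\<close>. With the witness \<open>z\<close>
  explicit, congruences become equations over the rationals that can be combined linearly.\<close>

definition lcong :: "nat \<Rightarrow> rat \<Rightarrow> rat \<Rightarrow> bool" where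
  "lcong k x y \<longleftrightarrow> (\<exists>z\<in>R. x = y + N ^ k * z)"

lemma n_nonzero [simp]: "n \<noteq> 0"
  using n_gt_1 by simp

lemma R_I: "b \<noteq> 0 \<Longrightarrow> coprime b (int n) \<Longrightarrow> of_int a / of_int b \<in> R"
  unfolding R_def by blast

lemma of_int_in_R [intro, simp]: "of_int a \<in> R"
  using R_I[of 1 a] by simp

lemma of_nat_in_R [intro, simp]: "of_nat a \<in> R"
  using of_int_in_R[of "int a"] by simp

lemma numeral_in_R [intro, simp]: "0 \<in> R" "1 \<in> R" "numeral w \<in> R"
  using of_int_in_R[of 0] of_int_in_R[of 1] of_int_in_R[of "numeral w"] by simp_all

lemma add_in_R [intro, simp]: assumes "x \<in> R" "y \<in> R" shows "x + y \<in> R"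
proof -
  obtain a b c d where "x = of_int a / of_int b" "b \<noteq> 0" "coprime b (int n)"
    "y = of_int c / of_int d" "d \<noteq> 0" "coprime d (int n)"
    using assms unfolding R_def by blast
  then show ?thesis
    using R_I[of "b * d" "a * d + c * b"] by (simp add: add_frac_eq)
qed

lemma mult_in_R [intro, simp]: assumes "x \<in> R" "y \<in> R" shows "x * y \<in> R"
proof -
  obtain a b c d where "x = of_int a / of_int b" "b \<noteq> 0" "coprime b (int n)"
    "y = of_int c / of_int d" "d \<noteq> 0" "coprime d (int n)"
    using assms unfolding R_def by blast
  then show ?thesis
    using R_I[of "b * d" "a * c"] by simp
qed

lemma uminus_in_R [intro, simp]: "x \<in> R \<Longrightarrow> - x \<in> R"
  using mult_in_R[OF of_int_in_R[of "- 1"], of x] by simp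

lemma diff_in_R [intro, simp]: "x \<in> R \<Longrightarrow> y \<in> R \<Longrightarrow> x - y \<in> R"
  using add_in_R[of x "- y"] by simp

lemma power_in_R [intro, simp]: "x \<in> R \<Longrightarrow> x ^ k \<in> R"
  by (induction k) auto

lemma sum_in_R [intro, simp]: "(\<And>s. s \<in> A \<Longrightarrow> f s \<in> R) \<Longrightarrow> sum f A \<in> R"
  by (induction A rule: infinite_finite_induct) auto

lemma inverse_in_R: assumes "coprime s n" shows "1 / of_nat s \<in> R"
proof -
  have "s \<noteq> 0"
    using assms n_gt_1 by (metis coprime_0_left_iff nat_dvd_1_iff_1 less_irrefl)
  then show ?thesis
    using R_I[of "int s" 1] assms by simp
qed

lemma divide_in_R: assumes "x \<in> R" "coprime s n" shows "x / of_nat s \<in> R"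
  using mult_in_R[OF assms(1) inverse_in_R[OF assms(2)]] by simp

lemma coprimes: "coprime 2 n" "coprime 3 n" "coprime 4 n" "coprime 6 n"
proof -
  show 6: "coprime 6 n"
    using coprime_6 by (simp add: coprime_commute)
  then show 2: "coprime 2 n" and "coprime 3 n"
    using coprime_mult_left_iff[of 2 3 n] by auto
  show "coprime 4 n"
    using 2 coprime_mult_left_iff[of 2 2 n] by simp
qed

text \<open>Here \<open>coprime n 6\<close> enters: every constant that later witnesses are divided
  by is one of these or a succession of them.\<close>

lemma divide_numeral_in_R:
  assumes "x \<in> R" shows "x / 2 \<in> R" "x / 3 \<in> R" "x / 4 \<in> R" "x / 6 \<in> R"
  using assms divide_in_R[of x 2] divide_in_R[of x 3] divide_in_R[of x 4] divide_in_R[of x 6] coprimes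
  by simp_all

lemmas R_intros = add_in_R diff_in_R mult_in_R uminus_in_R power_in_R of_nat_in_R numeral_in_R
  divide_numeral_in_R

lemma lcongI: "z \<in> R \<Longrightarrow> x = y + N ^ k * z \<Longrightarrow> lcong k x y"
  unfolding lcong_def by blast

lemma lcong_sum:
  assumes "\<And>s. s \<in> A \<Longrightarrow> lcong k (f s) (g s)"
  shows "lcong k (sum f A) (sum g A)"
proof -
  obtain z where z: "z s \<in> R \<and> f s = g s + N ^ k * z s" if "s \<in> A" for s
    using assms unfolding lcong_def by metis
  have "sum f A = sum g A + N ^ k * sum z A"
    by (simp add: sum.distrib sum_distrib_left z)
  with z show ?thesis
    by (intro lcongI[of "sum z A"]) auto
qed

text \<open>Cross-multiplying the reduced fraction \<open>p / r\<close> of \<open>x - y\<close>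
  gives \<open>p * b = n ^ k * a * r\<close>, and \<open>b\<close> is prime to
  \<open>n\<close>.\<close>

lemma lcong_imp_rat_cong:
  assumes "lcong k x y" shows "[x = y] (rmod int n ^ k)"
proof -
  obtain a b where ab: "b \<noteq> 0" "coprime b (int n)"
    and xy: "x = y + N ^ k * (of_int a / of_int b)"
    using assms unfolding lcong_def R_def by blast
  obtain p r where pr: "quotient_of (x - y) = (p, r)" by fastforce
  then have r: "r > 0" using quotient_of_denom_pos by blast
  have "of_int p / of_int r = N ^ k * (of_int a / of_int b)"
    using quotient_of_div[OF pr] xy by simp
  then have "(of_int (p * b) :: rat) = of_int (int n ^ k * a * r)"
    using r ab(1) by (simp add: field_simps)
  then have "p * b = int n ^ k * a * r"
    by (simp only: of_int_eq_iff)
  then have "int n ^ k dvd p * b" by simp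
  then have "int n ^ k dvd p"
    using ab(2) by (simp add: coprime_dvd_mult_left_iff coprime_commute)
  then show ?thesis by (simp add: rat_cong_def pr)
qed

section \<open>Reciprocal sums over residue classes\<close>

definition U :: "nat set" where
  "U = {s. 0 < s \<and> s < n \<and> coprime s n}"

text \<open>The classes modulo \<open>m\<close> are indexed by \<open>k\<close> with \<open>s \<equiv> - k n\<close>, so that \<open>s \<mapsto> n - s\<close> exchanges
  the classes \<open>k\<close> and \<open>m - 1 - k\<close>.\<close>

definition T :: "nat \<Rightarrow> nat \<Rightarrow> nat \<Rightarrow> rat" where
  "T j m k = (\<Sum>s | s \<in> U \<and> m dvd s + k * n. 1 / of_nat s ^ j)"

lemma finite_U [simp]: "finite U"
  by (rule finite_subset[of _ "{..<n}"]) (auto simp: U_def)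

lemma U_eq_totatives: "U = totatives n"
  using n_gt_1 by (auto simp: U_def totatives_def intro: le_neq_implies_less)

lemma card_U: "card U = totient n"
  by (simp add: U_eq_totatives totient_def)

lemma U_inverse_in_R [intro]: "s \<in> U \<Longrightarrow> 1 / of_nat s \<in> R"
  by (auto simp: U_def intro: inverse_in_R)

lemma U_inverse_power_in_R [intro]: "s \<in> U \<Longrightarrow> 1 / of_nat s ^ j \<in> R"
  using power_in_R[OF U_inverse_in_R, of s j] by (simp add: power_one_over)

lemma T_in_R [intro, simp]: "T j m k \<in> R"
  unfolding T_def by auto

lemma ex1_class:
  assumes "coprime m n" "m > 0"
  shows "\<exists>!k. k < m \<and> m dvd s + k * n"
proof -
  obtain x where x: "[n * x = 1] (mod m)"
    using assms(1) cong_solve_coprime_nat[of n m] by (auto simp: coprime_commute)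
  \<comment> \<open>\<open>m - 1\<close> stands for -1 modulo \<open>m\<close> and \<open>x\<close>
    for the inverse of \<open>n\<close>, so \<open>x * ((m - 1) * s)\<close> represents
    \<open>- s / n\<close>; it is reduced modulo \<open>m\<close> below.\<close>
  have "[s + n * x * ((m - 1) * s) = s + 1 * ((m - 1) * s)] (mod m)"
    by (intro cong_add cong_mult x cong_refl)
  moreover have "s + 1 * ((m - 1) * s) = m * s"
    using assms(2) by (cases m) auto
  ultimately have "m dvd s + n * x * ((m - 1) * s)"
    by (simp add: cong_dvd_iff)
  then have "[s + n * (x * ((m - 1) * s)) = 0] (mod m)"
    by (simp add: cong_0_iff mult.assoc)
  moreover have "[s + n * ((x * ((m - 1) * s)) mod m) = s + n * (x * ((m - 1) * s))] (mod m)"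
    by (intro cong_add cong_mult cong_refl) simp
  ultimately have "m dvd s + n * ((x * ((m - 1) * s)) mod m)"
    using cong_trans cong_0_iff by blast
  then have "\<exists>k. k < m \<and> m dvd s + k * n"
    using assms(2) by (metis mod_less_divisor mult.commute)
  moreover have "k = l" if "k < m" "m dvd s + k * n" "l < m" "m dvd s + l * n" for k l
  proof -
    have "[s + k * n = s + l * n] (mod m)"
      using that by (metis cong_0_iff cong_sym cong_trans)
    then have "[k = l] (mod m)"
      using assms(1) by (simp add: cong_add_lcancel_nat cong_mult_rcancel_nat coprime_commute)
    with that show ?thesis by (simp add: cong_less_modulus_unique_nat)
  qed
  ultimately show ?thesis by blast
qed

definition lift_index :: "nat \<Rightarrow> nat \<Rightarrow> nat" where
  "lift_index m s = (THE k. k < m \<and> m dvd s + k * n)"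

lemma
  assumes "coprime m n" "m > 0"
  shows lift_index_less: "lift_index m s < m" and lift_index_dvd: "m dvd s + lift_index m s * n"
  using theI'[OF ex1_class[OF assms, of s]] unfolding lift_index_def by auto

lemma lift_index_eq_iff:
  assumes "coprime m n" "m > 0" "k < m"
  shows "lift_index m s = k \<longleftrightarrow> m dvd s + k * n"
  using ex1_class[OF assms(1,2), of s] lift_index_less[OF assms(1,2)] lift_index_dvd[OF assms(1,2)] assms(3)
  by blast

text \<open>Units are grouped by their class. The weight \<open>h\<close> will be 1,
  \<open>k\<close>, the square of \<open>k\<close>, or the indicator of a coarser class.\<close>

lemma sum_by_lift_index:
  assumes "coprime m n" "m > 0"
  shows "(\<Sum>s\<in>U. h (lift_index m s) * (1 / of_nat s ^ j)) = (\<Sum>k<m. h k * T j m k)"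
proof -
  have T: "T j m k = (\<Sum>s | s \<in> U \<and> lift_index m s = k. 1 / of_nat s ^ j)" if "k < m" for k
    unfolding T_def by (simp only: lift_index_eq_iff[OF assms that])
  have "(\<Sum>k<m. h k * T j m k)
      = (\<Sum>k<m. \<Sum>s | s \<in> U \<and> lift_index m s = k. h (lift_index m s) * (1 / of_nat s ^ j))"
    by (intro sum.cong refl) (simp add: T sum_distrib_left)
  also have "\<dots> = (\<Sum>s\<in>U. h (lift_index m s) * (1 / of_nat s ^ j))"
    by (rule sum.group) (auto simp: lift_index_less assms)
  finally show ?thesis by simp
qed

text \<open>As \<open>d\<close> divides \<open>m\<close>, it divides
  \<open>s + lift_index m s * n\<close>; hence the class of \<open>s\<close> modulo \<open>d\<close>
  is the residue of \<open>lift_index m s\<close>.\<close>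

lemma T_coarsen:
  assumes "coprime m n" "m > 0" "d dvd m"
  shows "T j d k = (\<Sum>i | i < m \<and> [i = k] (mod d). T j m i)"
proof -
  have d: "coprime d n"
    by (rule coprime_divisors[OF assms(3) dvd_refl assms(1)])
  have iff: "d dvd s + k * n \<longleftrightarrow> [lift_index m s = k] (mod d)" for s
  proof -
    have "d dvd s + lift_index m s * n"
      using assms(3) lift_index_dvd[OF assms(1,2)] by (rule dvd_trans)
    then have "d dvd s + k * n \<longleftrightarrow> [s + lift_index m s * n = s + k * n] (mod d)"
      by (auto simp: cong_def dvd_eq_mod_eq_0)
    also have "\<dots> \<longleftrightarrow> [lift_index m s = k] (mod d)"
      using d by (simp add: cong_add_lcancel_nat cong_mult_rcancel_nat coprime_commute)
    finally show ?thesis .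
  qed
  have "T j d k = (\<Sum>s\<in>U. of_bool [lift_index m s = k] (mod d) * (1 / of_nat s ^ j))"
    unfolding T_def by (intro sum.mono_neutral_cong_left) (auto simp: iff)
  also have "\<dots> = (\<Sum>i<m. of_bool [i = k] (mod d) * T j m i)"
    by (rule sum_by_lift_index[OF assms(1,2), of "\<lambda>i. of_bool [i = k] (mod d)"])
  also have "\<dots> = (\<Sum>i | i < m \<and> [i = k] (mod d). T j m i)"
    by (intro sum.mono_neutral_cong_right) auto
  finally show ?thesis .
qed

section \<open>The reflection of the units\<close>

lemma U_reflect: "s \<in> U \<Longrightarrow> n - s \<in> U"
  unfolding U_def mem_Collect_eq
  by (metis coprime_iff_gcd_eq_1 diff_less gcd.commute gcd_diff2_nat less_imp_le less_trans zero_less_diff)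

lemma T_reindex:
  assumes "k < m"
  shows "T j m (m - 1 - k) = (\<Sum>s | s \<in> U \<and> m dvd s + k * n. 1 / of_nat (n - s) ^ j)"
  unfolding T_def
proof (rule sum.reindex_bij_witness[where i = "\<lambda>s. n - s" and j = "\<lambda>s. n - s"])
  have dvd: "m dvd (n - s) + l' * n" if "m dvd s + l * n" "l + l' + 1 = m" "s \<in> U" for s l l'
  proof -
    \<comment> \<open>The two lifted numbers add up to \<open>m * n\<close>, so \<open>m\<close>
      divides both or neither.\<close>
    have "(s + l * n) + ((n - s) + l' * n) = (l + l' + 1) * n"
      using that(3) by (simp add: U_def algebra_simps)
    then show ?thesis
      using that(1,2) by (metis dvd_add_right_iff dvd_triv_left)
  qed
  fix s
  {
    assume s: "s \<in> {s \<in> U. m dvd s + (m - 1 - k) * n}"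
    then show "n - (n - s) = s" "1 / of_nat (n - (n - s)) ^ j = 1 / of_nat s ^ j"
      by (auto simp: U_def)
    show "n - s \<in> {s \<in> U. m dvd s + k * n}"
      using s assms U_reflect dvd[of s "m - 1 - k" k] by auto
  next
    assume s: "s \<in> {s \<in> U. m dvd s + k * n}"
    then show "n - (n - s) = s"
      by (auto simp: U_def)
    show "n - s \<in> {s \<in> U. m dvd s + (m - 1 - k) * n}"
      using s assms U_reflect dvd[of s k "m - 1 - k"] by auto
  }
qed

text \<open>Termwise, \<open>1/(n - s)\<close> is the geometric series
  \<open>-1/s - n/s^2 - ...\<close>, cut off with exact remainder
  \<open>n^2 / (s^2 (n - s))\<close>.\<close>

lemma T1_reflect:
  assumes "k < m"
  shows "\<exists>z\<in>R. T 1 m (m - 1 - k) = - T 1 m k - N * T 2 m k + N\<^sup>2 * z"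
proof -
  have "lcong 2 (1 / of_nat (n - s)) (- (1 / of_nat s) - N * (1 / of_nat s ^ 2))" if "s \<in> U" for s
  proof (rule lcongI)
    show "1 / of_nat s ^ 2 * (1 / of_nat (n - s)) \<in> R"
      using that U_reflect by (intro mult_in_R U_inverse_in_R U_inverse_power_in_R)
    have "of_nat (n - s) = N - of_nat s" "(of_nat s :: rat) \<noteq> 0" "(of_nat (n - s) :: rat) \<noteq> 0"
      using that by (auto simp: U_def of_nat_diff)
    then show "1 / of_nat (n - s) = - (1 / of_nat s) - N * (1 / of_nat s ^ 2)
        + N ^ 2 * (1 / of_nat s ^ 2 * (1 / of_nat (n - s)))"
      by (simp add: divide_simps) (simp add: algebra_simps power2_eq_square)
  qed
  then have "lcong 2 (T 1 m (m - 1 - k))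
      (\<Sum>s | s \<in> U \<and> m dvd s + k * n. - (1 / of_nat s) - N * (1 / of_nat s ^ 2))"
    unfolding T_reindex[OF assms] by (intro lcong_sum) auto
  then show ?thesis
    unfolding lcong_def T_def by (simp add: sum_subtractf sum_negf sum_distrib_left)
qed

text \<open>Squares are even modulo \<open>n\<close>. First order suffices, since these sums will
  carry a factor \<open>N\<close>.\<close>

lemma T2_reflect:
  assumes "k < m"
  shows "\<exists>z\<in>R. T 2 m (m - 1 - k) = T 2 m k + N * z"
proof -
  have "lcong 1 (1 / of_nat (n - s) ^ 2) (1 / of_nat s ^ 2)" if "s \<in> U" for s
  proof (rule lcongI)
    show "(2 * of_nat s - N) * (1 / of_nat s ^ 2 * (1 / of_nat (n - s) ^ 2)) \<in> R"
      using that U_reflect by (intro R_intros U_inverse_power_in_R)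
    have "of_nat (n - s) = N - of_nat s" "(of_nat s :: rat) \<noteq> 0" "(of_nat (n - s) :: rat) \<noteq> 0"
      using that by (auto simp: U_def of_nat_diff)
    then show "1 / of_nat (n - s) ^ 2 = 1 / of_nat s ^ 2
        + N ^ 1 * ((2 * of_nat s - N) * (1 / of_nat s ^ 2 * (1 / of_nat (n - s) ^ 2)))"
      by (simp add: divide_simps) (simp add: algebra_simps power2_eq_square)
  qed
  then have "lcong 1 (T 2 m (m - 1 - k)) (T 2 m k)"
    unfolding T_reindex[OF assms] unfolding T_def by (intro lcong_sum) auto
  then show ?thesis
    unfolding lcong_def by simp
qed

section \<open>Division by \<open>m\<close> modulo \<open>n\<close>\<close>

text \<open>For a unit \<open>s\<close> below \<open>n\<close> and \<open>m\<close> prime to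
  \<open>n\<close>, this is the representative of \<open>s / m\<close> modulo \<open>n\<close> among
  the units below \<open>n\<close>.\<close>

definition div_modn :: "nat \<Rightarrow> nat \<Rightarrow> nat" where
  "div_modn m s = (s + lift_index m s * n) div m"

lemma mult_div_modn:
  assumes "coprime m n" "m > 0"
  shows "m * div_modn m s = s + lift_index m s * n"
  using lift_index_dvd[OF assms] by (simp add: div_modn_def)

text \<open>Values stay below \<open>n\<close> because \<open>s + (m - 1) n < m n\<close>. Reducing
  \<open>m * div_modn m s\<close> modulo \<open>n\<close> recovers \<open>s\<close>, so the map is
  injective, and finiteness gives surjectivity.\<close>

lemma bij_div_modn:
  assumes "coprime m n" "m > 0"
  shows "bij_betw (div_modn m) U U"
proof -
  have "div_modn m s \<in> U" if "s \<in> U" for s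
  proof -
    have s: "0 < s" "s < n" "coprime s n" using that by (auto simp: U_def)
    have eq: "m * div_modn m s = s + lift_index m s * n" by (rule mult_div_modn[OF assms])
    have "lift_index m s * n \<le> (m - 1) * n"
      using lift_index_less[OF assms, of s] by (intro mult_right_mono) auto
    moreover have "n + (m - 1) * n = m * n"
      using assms(2) by (cases m) auto
    ultimately have "m * div_modn m s < m * n"
      using s eq by linarith
    then have "div_modn m s < n" by simp
    moreover have "div_modn m s > 0" using eq s(1) by (cases "div_modn m s") auto
    moreover have "coprime (m * div_modn m s) n"
      unfolding eq using s(3)
      by (metis add.commute coprime_iff_gcd_eq_1 gcd.commute gcd_add_mult)
    ultimately show ?thesis by (simp add: U_def)
  qed
  moreover have "inj_on (div_modn m) U"
  proof
    fix s t assume st: "s \<in> U" "t \<in> U" "div_modn m s = div_modn m t"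
    then have "s + lift_index m s * n = t + lift_index m t * n"
      by (metis mult_div_modn[OF assms])
    then have "(s + lift_index m s * n) mod n = (t + lift_index m t * n) mod n" by simp
    with st show "s = t" by (simp add: U_def)
  qed
  ultimately show ?thesis
    by (simp add: bij_betw_def endo_inj_surj image_subsetI)
qed

text \<open>Multiply \<open>m * div_modn m s = s * (1 + N * k / s)\<close>, where
  \<open>k = lift_index m s\<close>, over all units; the product of the units cancels.\<close>

lemma power_totient_eq_prod:
  assumes "coprime m n" "m > 0"
  shows "of_nat m ^ totient n = (\<Prod>s\<in>U. 1 + N * (of_nat (lift_index m s) / of_nat s))"
proof -
  have nz: "(\<Prod>s\<in>U. of_nat s :: rat) \<noteq> 0" by (auto simp: U_def)
  have "of_nat m ^ totient n * (\<Prod>s\<in>U. of_nat s :: rat) = of_nat m ^ card U * (\<Prod>s\<in>U. of_nat (div_modn m s))"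
    by (simp add: card_U prod.reindex_bij_betw[OF bij_div_modn[OF assms], of of_nat])
  also have "\<dots> = (\<Prod>s\<in>U. of_nat (m * div_modn m s))"
    by (simp add: prod.distrib)
  also have "\<dots> = (\<Prod>s\<in>U. (1 + N * (of_nat (lift_index m s) / of_nat s)) * of_nat s)"
    by (intro prod.cong refl) (auto simp: mult_div_modn[OF assms] U_def field_simps)
  also have "\<dots> = (\<Prod>s\<in>U. 1 + N * (of_nat (lift_index m s) / of_nat s)) * (\<Prod>s\<in>U. of_nat s)"
    by (rule prod.distrib)
  finally show ?thesis using nz by simp
qed

text \<open>Halving modulo \<open>n\<close> permutes the units and multiplies each summand by 4, whence \<open>3 B \<equiv> 0\<close>.\<close>

lemma sum_inverse_squares: "\<exists>z\<in>R. (\<Sum>s\<in>U. 1 / of_nat s ^ 2) = N * z"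
proof -
  let ?B = "\<Sum>s\<in>U. 1 / of_nat s ^ 2 :: rat"
  have m: "coprime 2 n" "(2::nat) > 0" by (rule coprimes) simp
  have "lcong 1 (1 / of_nat (div_modn 2 s) ^ 2) (4 * (1 / of_nat s ^ 2))" if "s \<in> U" for s
  proof (rule lcongI)
    define c where "c = (of_nat (lift_index 2 s) :: rat)"
    define a where "a = (of_nat s :: rat)"
    define b where "b = (of_nat (div_modn 2 s) :: rat)"
    have "div_modn 2 s \<in> U" using bij_div_modn[OF m] that by (meson bij_betwE)
    then have nz: "a \<noteq> 0" "b \<noteq> 0" using that by (auto simp: U_def a_def b_def)
    have "of_nat (2 * div_modn 2 s) = (of_nat (s + lift_index 2 s * n) :: rat)"
      by (simp only: mult_div_modn[OF m])
    then have eq: "2 * b = a + c * N" by (simp add: a_def b_def c_def)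
    show "- c * (2 * a + c * N) * (1 / of_nat s ^ 2 * (1 / of_nat (div_modn 2 s) ^ 2)) \<in> R"
      using that \<open>div_modn 2 s \<in> U\<close> unfolding a_def c_def
      by (intro R_intros U_inverse_power_in_R)
    have "a ^ 2 = 4 * b ^ 2 + N * (- c * (2 * a + c * N))"
      using arg_cong[OF eq, of "\<lambda>x. x\<^sup>2"] by (simp add: algebra_simps power2_eq_square)
    then show "1 / of_nat (div_modn 2 s) ^ 2 = 4 * (1 / of_nat s ^ 2)
        + N ^ 1 * (- c * (2 * a + c * N) * (1 / of_nat s ^ 2 * (1 / of_nat (div_modn 2 s) ^ 2)))"
      using nz unfolding a_def[symmetric] b_def[symmetric] by (simp add: field_simps)
  qed
  then have "lcong 1 (\<Sum>s\<in>U. 1 / of_nat (div_modn 2 s) ^ 2) (\<Sum>s\<in>U. 4 * (1 / of_nat s ^ 2))"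
    by (rule lcong_sum)
  moreover have "(\<Sum>s\<in>U. 1 / of_nat (div_modn 2 s) ^ 2) = ?B"
    by (rule sum.reindex_bij_betw[OF bij_div_modn[OF m]])
  ultimately obtain z where "z \<in> R" "?B = 4 * ?B + N * z"
    unfolding lcong_def by (auto simp: sum_distrib_left)
  then show ?thesis
    \<comment> \<open>From \<open>B = 4 B + N z\<close>; dividing by 3 stays inside
      \<open>R\<close>.\<close>
    by (intro bexI[of _ "- z / 3"] R_intros) auto
qed

lemma sum_T2:
  assumes "coprime m n" "m > 0"
  shows "\<exists>z\<in>R. (\<Sum>k<m. T 2 m k) = N * z"
  using sum_inverse_squares sum_by_lift_index[OF assms, of "\<lambda>_. 1" 2] by simp

text \<open>Leudesdorf's congruence. Modulo 1 all units form one class, which reflection preserves: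
  twice the sum is \<open>- N * T 2 1 0\<close> up to \<open>N^2\<close>, and \<open>T 2 1 0\<close>
  is itself a multiple of \<open>N\<close>.\<close>

lemma sum_T1:
  assumes "coprime m n" "m > 0"
  shows "\<exists>z\<in>R. (\<Sum>k<m. T 1 m k) = N\<^sup>2 * z"
proof -
  have T: "(\<Sum>k<m. T j m k) = T j 1 0" for j
    using sum_by_lift_index[OF assms, of "\<lambda>_. 1" j] by (simp add: T_def)
  obtain y where y: "y \<in> R" "T 2 1 0 = N * y"
    using sum_T2[OF assms] unfolding T by blast
  obtain z where "z \<in> R" "T 1 1 0 = - T 1 1 0 - N * T 2 1 0 + N\<^sup>2 * z"
    using T1_reflect[of 0 1] by auto
  with y show ?thesis
    unfolding T by (intro bexI[of _ "(z - y) / 2"] R_intros) (auto simp: field_simps power2_eq_square)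
qed

text \<open>The coefficient of \<open>N^2\<close> is the second elementary symmetric function,
  written in power sums by Newton's identity.\<close>

lemma prod_one_plus:
  assumes "finite S" "\<And>s. s \<in> S \<Longrightarrow> t s \<in> R"
  shows "\<exists>z\<in>R. (\<Prod>s\<in>S. 1 + N * t s)
           = 1 + N * (\<Sum>s\<in>S. t s) + N\<^sup>2 * (((\<Sum>s\<in>S. t s)\<^sup>2 - (\<Sum>s\<in>S. (t s)\<^sup>2)) / 2) + N ^ 3 * z"
  using assms
proof (induction rule: finite_induct)
  case empty
  show ?case by (intro bexI[of _ 0]) auto
next
  case (insert x S)
  define p where "p = (\<Sum>s\<in>S. t s)"
  define r where "r = (\<Sum>s\<in>S. (t s)\<^sup>2)"
  have pr: "p \<in> R" "r \<in> R" "t x \<in> R" using insert by (auto simp: p_def r_def)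
  obtain z where z: "z \<in> R" "(\<Prod>s\<in>S. 1 + N * t s) = 1 + N * p + N\<^sup>2 * ((p\<^sup>2 - r) / 2) + N ^ 3 * z"
    using insert unfolding p_def r_def by blast
  \<comment> \<open>The terms of order at least 3 after multiplying by
    \<open>1 + N * t x\<close>.\<close>
  let ?z = "z + (p\<^sup>2 - r) / 2 * t x + N * z * t x"
  have "?z \<in> R" using pr z by (intro R_intros)
  moreover have "(1 + N * t x) * (1 + N * p + N\<^sup>2 * ((p\<^sup>2 - r) / 2) + N ^ 3 * z)
      = 1 + N * (t x + p) + N\<^sup>2 * (((t x + p)\<^sup>2 - ((t x)\<^sup>2 + r)) / 2) + N ^ 3 * ?z"
    by (simp add: field_simps power2_eq_square power3_eq_cube)
  ultimately show ?case
    using insert z by (intro bexI[of _ ?z]) (simp_all add: p_def r_def)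
qed

section \<open>Fermat quotients and weighted class sums\<close>

lemma fq_in_R: "coprime m n \<Longrightarrow> fermat_quotient n (int m) \<in> R"
  using fermat_quotient_in_Ints[of n "int m"] n_gt_1 by (auto elim!: Ints_cases)

text \<open>Expanding the product for \<open>m ^ totient n\<close> modulo \<open>N^3\<close> and
  dividing by \<open>N\<close> leaves precision \<open>N^2\<close>. This is the source of all Fermat
  quotients below.\<close>

lemma weighted_sum_T1:
  assumes "coprime m n" "m > 0"
  defines "q \<equiv> fermat_quotient n (int m)"
  shows "\<exists>z\<in>R. (\<Sum>k<m. of_nat k * T 1 m k)
           = q - N / 2 * q\<^sup>2 + N / 2 * (\<Sum>k<m. (of_nat k)\<^sup>2 * T 2 m k) + N\<^sup>2 * z"
proof -
  let ?t = "\<lambda>s. of_nat (lift_index m s) / of_nat s :: rat"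
  define p where "p = (\<Sum>k<m. of_nat k * T 1 m k)"
  define r where "r = (\<Sum>k<m. (of_nat k)\<^sup>2 * T 2 m k)"
  have t: "?t s \<in> R" if "s \<in> U" for s
    using that by (auto simp: U_def intro: divide_in_R)
  have sum_t: "(\<Sum>s\<in>U. ?t s) = p" and sum_t2: "(\<Sum>s\<in>U. (?t s)\<^sup>2) = r"
    using sum_by_lift_index[OF assms(1,2), of of_nat 1] sum_by_lift_index[OF assms(1,2), of "\<lambda>k. (of_nat k)\<^sup>2" 2]
    by (simp_all add: power_divide p_def r_def)
  obtain z where z: "z \<in> R"
    "of_nat m ^ totient n = 1 + N * p + N\<^sup>2 * ((p\<^sup>2 - r) / 2) + N ^ 3 * z"
    using prod_one_plus[of U ?t, OF finite_U t]
    unfolding power_totient_eq_prod[OF assms(1,2)] sum_t sum_t2 by auto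
  have pr: "p \<in> R" "r \<in> R" by (auto simp: p_def r_def)
  have "N * q = of_nat m ^ totient n - 1"
    by (simp add: q_def fermat_quotient_def)
  also have "\<dots> = N * (p + N * ((p\<^sup>2 - r) / 2) + N\<^sup>2 * z)"
    by (simp add: z(2) algebra_simps power2_eq_square power3_eq_cube)
  finally have q: "q = p + N * ((p\<^sup>2 - r) / 2) + N\<^sup>2 * z"
    by simp
  \<comment> \<open>\<open>w\<close> records that \<open>q\<close> and \<open>p\<close> agree modulo
    \<open>N\<close>, so \<open>N/2 * p^2\<close> may be exchanged for \<open>N/2 * q^2\<close> at
    the cost of a multiple of \<open>N^2\<close>.\<close>
  define w where "w = (p\<^sup>2 - r) / 2 + N * z"
  have w: "w \<in> R" unfolding w_def using pr z(1) by (intro R_intros)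
  have qw: "q = p + N * w"
    by (simp add: q w_def algebra_simps power2_eq_square)
  have "N / 2 * q\<^sup>2 = N / 2 * p\<^sup>2 + N\<^sup>2 * (w * p + N * w\<^sup>2 / 2)"
    unfolding qw by (simp add: field_simps power2_eq_square)
  then have "p = q - N / 2 * q\<^sup>2 + N / 2 * r + N\<^sup>2 * (w * p + N * w\<^sup>2 / 2 - z)"
    unfolding q by (simp add: field_simps)
  moreover have "w * p + N * w\<^sup>2 / 2 - z \<in> R"
    using w pr z(1) by (intro R_intros)
  ultimately show ?thesis unfolding p_def r_def by blast
qed

text \<open>Under \<open>s = n - m r\<close>, \<open>s\<close> is congruent to \<open>n\<close>,
  that is to \<open>-(m - 1) n\<close>, modulo \<open>m\<close>.\<close>

lemma sum_eq_T1:
  assumes "coprime m n" "m > 1"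
  shows "(\<Sum>r | r \<in> {1..n div m} \<and> gcd r n = 1. 1 / (N - of_nat m * of_nat r)) = T 1 m (m - 1)"
  unfolding T_def
proof (rule sum.reindex_bij_witness[where i = "\<lambda>s. (n - s) div m" and j = "\<lambda>r. n - m * r"])
  fix r assume "r \<in> {r. r \<in> {1..n div m} \<and> gcd r n = 1}"
  then have r: "1 \<le> r" "r \<le> n div m" "coprime r n"
    by (simp_all only: mem_Collect_eq atLeastAtMost_iff coprime_iff_gcd_eq_1)
  then have le: "m * r \<le> n"
    using assms(2) by (metis div_le_dividend div_times_less_eq_dividend le_trans mult.commute mult_le_mono2)
  have cop: "coprime (m * r) n" using r assms by simp
  \<comment> \<open>Coprimality excludes the endpoint, where the denominator would vanish.\<close>
  then have "m * r \<noteq> n" using n_gt_1 by auto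
  with le have lt: "m * r < n" by simp
  then show "(n - (n - m * r)) div m = r" using assms(2) by simp
  show "1 / of_nat (n - m * r) ^ 1 = 1 / (N - of_nat m * of_nat r)"
    using lt by (simp add: of_nat_diff)
  have "m * r \<in> U" using lt cop r(1) assms(2) by (simp add: U_def)
  moreover have "m dvd n - m * r + (m - 1) * n"
  proof -
    have "m * r + (n - m * r + (m - 1) * n) = m * n"
      using lt assms(2) by (cases m) auto
    then show ?thesis by (metis dvd_add_right_iff dvd_triv_left)
  qed
  ultimately show "n - m * r \<in> {s \<in> U. m dvd s + (m - 1) * n}"
    using U_reflect by blast
next
  fix s assume "s \<in> {s \<in> U. m dvd s + (m - 1) * n}"
  then have s: "s \<in> U" "s < n" "m dvd s + (m - 1) * n" by (auto simp: U_def)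
  have "(s + (m - 1) * n) + (n - s) = m * n"
    using s(2) assms(2) by (cases m) auto
  then have "m dvd n - s"
    using s(3) by (metis dvd_add_right_iff dvd_triv_left)
  then obtain r where r: "n - s = m * r" by blast
  have "m * r \<in> U" using U_reflect[OF s(1)] r by simp
  then have mr: "m * r < n" "0 < m * r" "coprime (m * r) n" by (auto simp: U_def)
  have "r \<le> n div m" using mr(1) assms(2) by (simp add: less_eq_div_iff_mult_less_eq mult.commute)
  with mr r assms(2) show "(n - s) div m \<in> {r. r \<in> {1..n div m} \<and> gcd r n = 1}"
    unfolding mem_Collect_eq coprime_iff_gcd_eq_1[symmetric] by auto
  show "n - m * ((n - s) div m) = s"
    using r s(2) assms(2) by auto
qed

section \<open>The moduli 2, 3, 4 and 6\<close>

lemma sum_lessThan: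
  fixes f :: "nat \<Rightarrow> rat"
  shows "sum f {..<2} = f 0 + f 1" "sum f {..<3} = f 0 + f 1 + f 2"
    "sum f {..<4} = f 0 + f 1 + f 2 + f 3"
    "sum f {..<6} = f 0 + f 1 + f 2 + f 3 + f 4 + f 5"
  by (simp_all add: numeral_eq_Suc)

text \<open>The symmetric hypothesis lets numerals be inserted without truncated
  subtraction.\<close>

lemma T1_reflect_obtain:
  assumes "k + l + 1 = m"
  obtains z where "z \<in> R" "T 1 m l = - T 1 m k - N * T 2 m k + N\<^sup>2 * z"
  using T1_reflect[of k m] assms
  by (metis add_diff_cancel_left' add_diff_cancel_right' less_add_Suc1 add_Suc_right
      add.right_neutral One_nat_def)

lemma N_T2_reflect:
  assumes "k + l + 1 = m"
  obtains z where "z \<in> R" "N * T 2 m l = N * T 2 m k + N\<^sup>2 * z"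
proof -
  have "k < m" "m - 1 - k = l" using assms by auto
  with T2_reflect[of k m] obtain z where "z \<in> R" "T 2 m l = T 2 m k + N * z" by auto
  then show ?thesis
    by (intro that[of z]) (auto simp: algebra_simps power2_eq_square)
qed

lemma N_sum_T2:
  assumes "coprime m n" "m > 0"
  obtains z where "z \<in> R" "N * (\<Sum>k<m. T 2 m k) = N\<^sup>2 * z"
  using sum_T2[OF assms] by (auto simp: power2_eq_square)

text \<open>Both classes have the same \<open>N * T 2\<close> modulo \<open>N^2\<close> and their
  sum vanishes, so the quadratic term drops out.\<close>

lemma T_two:
  defines "q \<equiv> fermat_quotient n 2"
  shows "\<exists>z\<in>R. T 1 2 1 = q - N * q\<^sup>2 / 2 + N\<^sup>2 * z"
proof -
  have m: "coprime 2 n" "(2::nat) > 0" by (rule coprimes) simp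
  obtain z1 where z1: "z1 \<in> R" "N * T 2 2 0 = N * T 2 2 1 + N\<^sup>2 * z1"
    by (rule N_T2_reflect[of 1 0 2]) auto
  obtain z2 where z2: "z2 \<in> R" "N * (T 2 2 0 + T 2 2 1) = N\<^sup>2 * z2"
    using N_sum_T2[OF m] unfolding sum_lessThan by blast
  obtain z3 where z3: "z3 \<in> R" "T 1 2 1 = q - N / 2 * q\<^sup>2 + N / 2 * T 2 2 1 + N\<^sup>2 * z3"
    using weighted_sum_T1[OF m] unfolding sum_lessThan q_def by auto
  have "T 1 2 1 = q - N * q\<^sup>2 / 2 + N\<^sup>2 * ((z2 - z1) / 4 + z3)"
    using z1(2) z2(2) z3(2) by (simp add: field_simps)
  moreover have "(z2 - z1) / 4 + z3 \<in> R"
    using z1(1) z2(1) z3(1) by (intro R_intros)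
  ultimately show ?thesis by blast
qed

text \<open>Subtracting the full sum from the weighted one leaves \<open>T 1 3 2 - T 1 3 0\<close>,
  which reflection turns into \<open>2 * T 1 3 2 + N * T 2 3 2\<close>. The square sums then combine
  into the vanishing total.\<close>

lemma T_three:
  defines "q \<equiv> fermat_quotient n 3"
  shows "\<exists>z\<in>R. T 1 3 2 = q / 2 - N * q\<^sup>2 / 4 + N\<^sup>2 * z"
proof -
  have m: "coprime 3 n" "(3::nat) > 0" by (rule coprimes) simp
  obtain z1 where z1: "z1 \<in> R" "N * T 2 3 0 = N * T 2 3 2 + N\<^sup>2 * z1"
    by (rule N_T2_reflect[of 2 0 3]) auto
  obtain z2 where z2: "z2 \<in> R" "N * (T 2 3 0 + T 2 3 1 + T 2 3 2) = N\<^sup>2 * z2"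
    using N_sum_T2[OF m] unfolding sum_lessThan by blast
  obtain z3 where z3: "z3 \<in> R" "T 1 3 1 + 2 * T 1 3 2
      = q - N / 2 * q\<^sup>2 + N / 2 * (T 2 3 1 + 4 * T 2 3 2) + N\<^sup>2 * z3"
    using weighted_sum_T1[OF m] unfolding sum_lessThan q_def by auto
  obtain z4 where z4: "z4 \<in> R" "T 1 3 0 = - T 1 3 2 - N * T 2 3 2 + N\<^sup>2 * z4"
    by (rule T1_reflect_obtain[of 2 0 3]) auto
  obtain z5 where z5: "z5 \<in> R" "T 1 3 0 + T 1 3 1 + T 1 3 2 = N\<^sup>2 * z5"
    using sum_T1[OF m] unfolding sum_lessThan by blast
  have "T 1 3 2 = q / 2 - N * q\<^sup>2 / 4 + N\<^sup>2 * ((z2 - z1) / 4 + (z3 - z5 + z4) / 2)"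
    using z1(2) z2(2) z3(2) z4(2) z5(2) by (simp add: field_simps)
  moreover have "(z2 - z1) / 4 + (z3 - z5 + z4) / 2 \<in> R"
    using z1(1) z2(1) z3(1) z4(1) z5(1) by (intro R_intros)
  ultimately show ?thesis by blast
qed

text \<open>Multiply \<open>a ^ totient n = 1 + N * q\<close> for the two factors. It reduces the
  bases 4 and 6 to 2 and 3.\<close>

lemma fermat_quotient_mult:
  "fermat_quotient n (a * b) = fermat_quotient n a + fermat_quotient n b
     + N * fermat_quotient n a * fermat_quotient n b"
proof -
  have fq: "of_int c ^ totient n = 1 + N * fermat_quotient n c" for c
    by (simp add: fermat_quotient_def)
  have "fermat_quotient n (a * b)
      = ((1 + N * fermat_quotient n a) * (1 + N * fermat_quotient n b) - 1) / N"
    by (simp only: fq[symmetric] power_mult_distrib of_int_mult fermat_quotient_def[of n "a * b"])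
  also have "\<dots> = N * (fermat_quotient n a + fermat_quotient n b
      + N * fermat_quotient n a * fermat_quotient n b) / N"
    by (simp add: algebra_simps)
  finally show ?thesis by simp
qed

text \<open>With \<open>t k = T 1 4 k\<close>, the weighted sum is
  \<open>2 (t 1 + t 2) - (t 1 + t 3) + 4 t 3\<close>: a reflected pair, a class modulo 2 and the
  unknown. The square sums collect to 9/2 times \<open>N * (T 2 4 2 + T 2 4 3)\<close>, half the
  vanishing total.\<close>

lemma T_four:
  defines "q \<equiv> fermat_quotient n 2"
  shows "\<exists>z\<in>R. T 1 4 3 = 3 / 4 * q - 3 / 8 * N * q\<^sup>2 + N\<^sup>2 * z"
proof -
  have m: "coprime 4 n" "(4::nat) > 0" by (rule coprimes) simp
  have q: "q \<in> R" using fq_in_R[OF coprimes(1)] by (simp add: q_def)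
  have q4: "fermat_quotient n 4 = 2 * q + N * q\<^sup>2"
    using fermat_quotient_mult[of 2 2] by (simp add: q_def power2_eq_square)
  obtain z1 where z1: "z1 \<in> R" "N * T 2 4 0 = N * T 2 4 3 + N\<^sup>2 * z1"
    by (rule N_T2_reflect[of 3 0 4]) auto
  obtain z1' where z1': "z1' \<in> R" "N * T 2 4 1 = N * T 2 4 2 + N\<^sup>2 * z1'"
    by (rule N_T2_reflect[of 2 1 4]) auto
  obtain z2 where z2: "z2 \<in> R" "N * (T 2 4 0 + T 2 4 1 + T 2 4 2 + T 2 4 3) = N\<^sup>2 * z2"
    using N_sum_T2[OF m] unfolding sum_lessThan by blast
  obtain z3 where z3: "z3 \<in> R" "T 1 4 1 + 2 * T 1 4 2 + 3 * T 1 4 3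
      = (2 * q + N * q\<^sup>2) - N / 2 * (2 * q + N * q\<^sup>2)\<^sup>2
        + N / 2 * (T 2 4 1 + 4 * T 2 4 2 + 9 * T 2 4 3) + N\<^sup>2 * z3"
    using weighted_sum_T1[OF m] unfolding sum_lessThan by (auto simp: q4)
  obtain z4 where z4: "z4 \<in> R" "T 1 4 1 = - T 1 4 2 - N * T 2 4 2 + N\<^sup>2 * z4"
    by (rule T1_reflect_obtain[of 2 1 4]) auto
  have "{i. i < 4 \<and> [i = 1] (mod 2)} = {1, 3 :: nat}"
    by (auto simp: cong_def) presburger
  then have "T 1 2 1 = T 1 4 1 + T 1 4 3"
    using T_coarsen[OF m, of 2 1 1] by simp
  with T_two obtain z5 where z5: "z5 \<in> R" "T 1 4 1 + T 1 4 3 = q - N * q\<^sup>2 / 2 + N\<^sup>2 * z5"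
    unfolding q_def by auto
  let ?w = "(4 * q * q\<^sup>2 + N * (q\<^sup>2)\<^sup>2) / 2"
  have "N / 2 * (2 * q + N * q\<^sup>2)\<^sup>2 = 2 * (N * q\<^sup>2) + N\<^sup>2 * ?w"
    by (simp add: field_simps power2_eq_square)
  then have "T 1 4 3 = 3 / 4 * q - 3 / 8 * N * q\<^sup>2
      + N\<^sup>2 * ((z3 - ?w + z5 + z1' / 2 + 9 * (z2 - z1 - z1') / 4 - 2 * z4) / 4)"
    using z1(2) z1'(2) z2(2) z3(2) z4(2) z5(2) by (simp add: field_simps)
  moreover have "(z3 - ?w + z5 + z1' / 2 + 9 * (z2 - z1 - z1') / 4 - 2 * z4) / 4 \<in> R"
    using q z1(1) z1'(1) z2(1) z3(1) z4(1) z5(1) by (intro R_intros)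
  ultimately show ?thesis by blast
qed

text \<open>With \<open>t k = T 1 6 k\<close>, the weighted sum is \<open>4 (t 1 + t 4) + 6 (t 2 + t
  3) - 3 (t 1 + t 3 + t 5) - 4 (t 2 + t 5) + 12 t 5\<close>. The square sums collect to 25/2 times
  half the vanishing total.\<close>

lemma T_six:
  defines "q \<equiv> fermat_quotient n 2" and "r \<equiv> fermat_quotient n 3"
  shows "\<exists>z\<in>R. T 1 6 5 = q / 3 + r / 4 - N * (q\<^sup>2 / 6 + r\<^sup>2 / 8) + N\<^sup>2 * z"
proof -
  have m: "coprime 6 n" "(6::nat) > 0" by (rule coprimes) simp
  have q: "q \<in> R" and r: "r \<in> R"
    using fq_in_R[OF coprimes(1)] fq_in_R[OF coprimes(2)] by (simp_all add: q_def r_def)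
  define q6 where "q6 = q + r + N * q * r"
  have q6: "fermat_quotient n 6 = q6"
    using fermat_quotient_mult[of 2 3] by (simp add: q_def r_def q6_def)
  obtain a0 where a0: "a0 \<in> R" "N * T 2 6 0 = N * T 2 6 5 + N\<^sup>2 * a0"
    by (rule N_T2_reflect[of 5 0 6]) auto
  obtain a1 where a1: "a1 \<in> R" "N * T 2 6 1 = N * T 2 6 4 + N\<^sup>2 * a1"
    by (rule N_T2_reflect[of 4 1 6]) auto
  obtain a2 where a2: "a2 \<in> R" "N * T 2 6 2 = N * T 2 6 3 + N\<^sup>2 * a2"
    by (rule N_T2_reflect[of 3 2 6]) auto
  obtain b where b: "b \<in> R"
    "N * (T 2 6 0 + T 2 6 1 + T 2 6 2 + T 2 6 3 + T 2 6 4 + T 2 6 5) = N\<^sup>2 * b"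
    using N_sum_T2[OF m] unfolding sum_lessThan by blast
  obtain c where c: "c \<in> R" "T 1 6 1 + 2 * T 1 6 2 + 3 * T 1 6 3 + 4 * T 1 6 4 + 5 * T 1 6 5
      = q6 - N / 2 * q6\<^sup>2 + N / 2 * (T 2 6 1 + 4 * T 2 6 2 + 9 * T 2 6 3 + 16 * T 2 6 4 + 25 * T 2 6 5)
        + N\<^sup>2 * c"
    using weighted_sum_T1[OF m] unfolding sum_lessThan by (auto simp: q6)
  obtain d1 where d1: "d1 \<in> R" "T 1 6 1 = - T 1 6 4 - N * T 2 6 4 + N\<^sup>2 * d1"
    by (rule T1_reflect_obtain[of 4 1 6]) auto
  obtain d2 where d2: "d2 \<in> R" "T 1 6 2 = - T 1 6 3 - N * T 2 6 3 + N\<^sup>2 * d2"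
    by (rule T1_reflect_obtain[of 3 2 6]) auto
  have "{i. i < 6 \<and> [i = 1] (mod 2)} = {1, 3, 5 :: nat}"
    by (auto simp: cong_def) presburger
  then have "T 1 2 1 = T 1 6 1 + T 1 6 3 + T 1 6 5"
    using T_coarsen[OF m, of 2 1 1] by simp
  with T_two obtain e2 where e2: "e2 \<in> R"
    "T 1 6 1 + T 1 6 3 + T 1 6 5 = q - N * q\<^sup>2 / 2 + N\<^sup>2 * e2"
    unfolding q_def by auto
  have "{i. i < 6 \<and> [i = 2] (mod 3)} = {2, 5 :: nat}"
    by (auto simp: cong_def) presburger
  then have "T 1 3 2 = T 1 6 2 + T 1 6 5"
    using T_coarsen[OF m, of 3 1 2] by simp
  with T_three obtain e3 where e3: "e3 \<in> R"
    "T 1 6 2 + T 1 6 5 = r / 2 - N * r\<^sup>2 / 4 + N\<^sup>2 * e3"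
    unfolding r_def by auto
  \<comment> \<open>The part of \<open>N/2 * q6^2\<close> of order at least 2; the cross terms
    \<open>N * q * r\<close> cancel.\<close>
  define w where "w = (2 * (q + r) * q * r + N * (q * r)\<^sup>2) / 2"
  have w: "w \<in> R"
    unfolding w_def using q r by (intro R_intros)
  have "q6 - N / 2 * q6\<^sup>2 = q + r - N * q\<^sup>2 / 2 - N * r\<^sup>2 / 2 - N\<^sup>2 * w"
    unfolding q6_def w_def by (simp add: field_simps power2_eq_square)
  then have "T 1 6 5 = q / 3 + r / 4 - N * (q\<^sup>2 / 6 + r\<^sup>2 / 8)
      + N\<^sup>2 * ((c - w + 3 * e2 + 4 * e3 + (a1 + 4 * a2) / 2 + 25 * (b - a0 - a1 - a2) / 4
               - 4 * d1 - 6 * d2) / 3 / 4)"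
    using a0(2) a1(2) a2(2) b(2) c(2) d1(2) d2(2) e2(2) e3(2) by (simp add: field_simps)
  moreover have "(c - w + 3 * e2 + 4 * e3 + (a1 + 4 * a2) / 2 + 25 * (b - a0 - a1 - a2) / 4
               - 4 * d1 - 6 * d2) / 3 / 4 \<in> R"
    using w a0(1) a1(1) a2(1) b(1) c(1) d1(1) d2(1) e2(1) e3(1) by (intro R_intros)
  ultimately show ?thesis by blast
qed

lemma T_imp_rat_cong:
  assumes "coprime m n" "m > 1" "\<exists>z\<in>R. T 1 m (m - 1) = y + N\<^sup>2 * z"
  shows "[(\<Sum>r | r \<in> {1..n div m} \<and> gcd r n = 1. 1 / (N - of_nat m * of_nat r)) = y] (rmod (int n)\<^sup>2)"
  unfolding sum_eq_T1[OF assms(1,2)]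
  by (rule lcong_imp_rat_cong) (use assms(3) in \<open>simp add: lcong_def\<close>)

end

theorem theorem1:
  fixes n :: nat
  assumes "n > 1" and "gcd n 6 = 1"
  shows "[(\<Sum>r | r \<in> {1..n div 3} \<and> gcd r n = 1. 1 / (of_nat n - 3 * of_nat r))
          = 1/2 * fermat_quotient n 3 - 1/4 * of_nat n * (fermat_quotient n 3)\<^sup>2] (rmod (int n)\<^sup>2) \<and>
         [(\<Sum>r | r \<in> {1..n div 4} \<and> gcd r n = 1. 1 / (of_nat n - 4 * of_nat r))
          = 3/4 * fermat_quotient n 2 - 3/8 * of_nat n * (fermat_quotient n 2)\<^sup>2] (rmod (int n)\<^sup>2) \<and>
         [(\<Sum>r | r \<in> {1..n div 6} \<and> gcd r n = 1. 1 / (of_nat n - 6 * of_nat r))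
          = 1/3 * fermat_quotient n 2 + 1/4 * fermat_quotient n 3
            - of_nat n * (1/6 * (fermat_quotient n 2)\<^sup>2 + 1/8 * (fermat_quotient n 3)\<^sup>2)] (rmod (int n)\<^sup>2)"
proof -
  interpret coprime_six n
    using assms by unfold_locales (simp_all only: coprime_iff_gcd_eq_1)
  show ?thesis
    using T_imp_rat_cong[OF coprimes(2) _, of "1/2 * fermat_quotient n 3 - 1/4 * N * (fermat_quotient n 3)\<^sup>2"]
      T_imp_rat_cong[OF coprimes(3) _, of "3/4 * fermat_quotient n 2 - 3/8 * N * (fermat_quotient n 2)\<^sup>2"]
      T_imp_rat_cong[OF coprimes(4) _, of "1/3 * fermat_quotient n 2 + 1/4 * fermat_quotient n 3
            - N * (1/6 * (fermat_quotient n 2)\<^sup>2 + 1/8 * (fermat_quotient n 3)\<^sup>2)"]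
      T_three T_four T_six
    by simp
qed

end
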